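(* Suppose there is an algorithm which takes as input a Diophantine equation (a polynomial equation $D(x_1,\ldots,x_n)=0$ with $D$ having integer coefficients) and returns an integer which is greater than the number of integer solutions of the equation whenever this number is finite. Then there is an algorithm which takes as input a Diophantine equation and returns an integer which is greater than the heights of all integer solutions of the equation whenever the set of integer solutions is finite.
   Context: The height of an integer tuple $(a_1,\ldots,a_n)$ is $\max(|a_1|,\ldots,|a_n|)$. *)

theory Defs
  imports Main "HOL-Library.Nat_Bijection"
begin

text \<open>
  Algorithms are modelled by partial recursive functions. \<open>Prim_Rec f g\<close> recurses on the
  first argument, with the step function receiving the counter, the previous value and the
  parameters; \<open>Mu f\<close> searches for the least first argument at which \<open>f\<close> vanishes.
\<close>

datatype recf =
    Zero
  | Succ
  | Proj nat
  | Comp recf "recf list"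
  | Prim_Rec recf recf
  | Mu recf

text \<open>
  The result \<open>None\<close> means that the computation diverges or that the number of arguments
  is inappropriate. All arguments of a composition must be defined, and an unbounded search
  succeeds only if \<open>f\<close> is defined at every value before the first zero.
\<close>

fun run :: "recf \<Rightarrow> nat list \<Rightarrow> nat option" where
  "run Zero xs = Some 0"
| "run Succ xs = (case xs of [x] \<Rightarrow> Some (Suc x) | _ \<Rightarrow> None)"
| "run (Proj i) xs = (if i < length xs then Some (xs ! i) else None)"
| "run (Comp f gs) xs =
     (let ys = map (\<lambda>g. run g xs) gs
      in if None \<in> set ys then None else run f (map the ys))"
| "run (Prim_Rec f g) xs =
     (case xs of
        [] \<Rightarrow> None
      | m # zs \<Rightarrow>
          rec_nat (run f zs) (\<lambda>k r. Option.bind r (\<lambda>v. run g (k # v # zs))) m)"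
| "run (Mu f) xs =
     (if \<exists>m. run f (m # xs) = Some 0 \<and> (\<forall>k<m. \<exists>v. run f (k # xs) = Some (Suc v))
      then Some (LEAST m. run f (m # xs) = Some 0)
      else None)"

text \<open>
  The pair \<open>(n, D)\<close> stands for the equation \<open>D(x\<^sub>1, \<dots>, x\<^sub>n) = 0\<close>. The polynomial is
  written as a finite sum of terms, where \<open>(c, [e\<^sub>1, \<dots>, e\<^sub>n])\<close> is the term
  \<open>c * x\<^sub>1 ^ e\<^sub>1 * \<dots> * x\<^sub>n ^ e\<^sub>n\<close>. The number of variables is recorded because it cannot
  be recovered from the empty sum. Repeated exponent vectors and zero coefficients are allowed.
\<close>

type_synonym dioph_eq = "nat \<times> (int \<times> nat list) list"

definition dioph_eqs :: "dioph_eq set" where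
  "dioph_eqs = {(n, D). n \<ge> 1 \<and> (\<forall>(c, es) \<in> set D. length es = n)}"

definition poly_value :: "dioph_eq \<Rightarrow> int list \<Rightarrow> int" where
  "poly_value E x = (\<Sum>(c, es) \<leftarrow> snd E. c * (\<Prod>i<fst E. (x ! i) ^ (es ! i)))"

definition solutions :: "dioph_eq \<Rightarrow> int list set" where
  "solutions E = {x. length x = fst E \<and> poly_value E x = 0}"

definition height :: "int list \<Rightarrow> int" where
  "height x = Max (abs ` set x)"

definition encode_eq :: "dioph_eq \<Rightarrow> nat" where
  "encode_eq E =
     prod_encode
       (fst E,
        list_encode (map (\<lambda>(c, es). prod_encode (int_encode c, list_encode es)) (snd E)))"

lemma inj_encode_eq: "inj encode_eq"
proof -
  have "inj (\<lambda>(c, es). prod_encode (int_encode c, list_encode es))"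
    by (auto simp: inj_def int_encode_eq list_encode_eq)
  then show ?thesis
    by (auto simp: inj_def encode_eq_def list_encode_eq inj_map_eq_map prod_eq_iff)
qed

text \<open>
  An algorithm has to halt with an integer on every Diophantine equation; its behaviour on numbers
  that do not encode an equation is irrelevant, and so is the value of \<open>F\<close> outside
  \<open>dioph_eqs\<close>.
\<close>

definition computable :: "(dioph_eq \<Rightarrow> int) \<Rightarrow> bool" where
  "computable F \<longleftrightarrow>
     (\<exists>p. \<forall>E \<in> dioph_eqs. run p [encode_eq E] = Some (int_encode (F E)))"

end

theory Submission
  imports Defs "HOL-Computational_Algebra.Primes"
begin

text \<open>
  To the equation \<open>D(x\<^sub>1, \<dots>, x\<^sub>n) = 0\<close> we associate the equation
  \<open>(x\<^sub>1\<^sup>2 + \<dots> + x\<^sub>n\<^sup>2 - y\<^sub>1\<^sup>2 - \<dots> - y\<^sub>5\<^sup>2)\<^sup>2 + D(x\<^sub>1, \<dots>, x\<^sub>n)\<^sup>2 = 0\<close>. Over each solution \<open>x\<close> of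
  the former lie finitely many solutions of the latter. There are more than \<open>height x\<close> of them:
  \<open>y\<^sub>1\<close> can be any of \<open>0, \<dots>, height x\<close>, and Lagrange's theorem supplies the other four
  squares. Hence a bound on the number of solutions of the new equation, which is computable from
  \<open>D\<close>, bounds the heights of the solutions of \<open>D\<close>.
\<close>

section \<open>Lagrange's four-square theorem\<close>

definition four_squares :: "int \<Rightarrow> bool" where
  "four_squares n \<longleftrightarrow> (\<exists>a b c d. n = a\<^sup>2 + b\<^sup>2 + c\<^sup>2 + d\<^sup>2)"

lemma euler_four_square_identity:
  fixes a b c d w x y z :: int
  shows "(a\<^sup>2 + b\<^sup>2 + c\<^sup>2 + d\<^sup>2) * (w\<^sup>2 + x\<^sup>2 + y\<^sup>2 + z\<^sup>2) =
    (a * w + b * x + c * y + d * z)\<^sup>2 + (a * x - b * w + c * z - d * y)\<^sup>2 +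
    (a * y - b * z - c * w + d * x)\<^sup>2 + (a * z + b * y - c * x - d * w)\<^sup>2"
  by (simp add: power2_eq_square algebra_simps)

lemma four_squares_mult: "four_squares m \<Longrightarrow> four_squares n \<Longrightarrow> four_squares (m * n)"
  unfolding four_squares_def using euler_four_square_identity by metis

lemma balanced_residue:
  fixes a m :: int
  assumes "m > 0"
  obtains b k where "a = b + m * k" "2 * \<bar>b\<bar> \<le> m"
proof -
  \<comment> \<open>\<open>q\<close> is \<open>a / m\<close> rounded to a nearest integer, the floor
    of \<open>a / m + 1 / 2\<close>.\<close>
  define q r where "q = (2 * a + m) div (2 * m)" and "r = (2 * a + m) mod (2 * m)"
  have "2 * a + m = 2 * (m * q) + r"
    using mult_div_mod_eq[of "2 * m" "2 * a + m"] by (simp add: mult.assoc q_def r_def)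
  moreover have "0 \<le> r" "r < 2 * m"
    using assms by (simp_all add: r_def)
  ultimately have "2 * (a - m * q) \<le> m \<and> - m \<le> 2 * (a - m * q)"
    by (simp add: right_diff_distrib)
  then have "2 * \<bar>a - m * q\<bar> \<le> m" by (simp add: abs_if)
  then show thesis using that[of "a - m * q" q] by simp
qed

text \<open>Fermat's descent. The balanced residues \<open>b\<close> of the four roots modulo
  \<open>m\<close> have squares summing to \<open>m * r\<close> with \<open>0 < r < m\<close>.
  Keeping the quotients \<open>k\<close> as well expresses \<open>r * p\<close> directly as four
  squares.\<close>

lemma four_squares_descent:
  fixes m p :: int
  assumes "prime p" "1 < m" "m < p" "four_squares (m * p)"
  obtains r where "0 < r" "r < m" "four_squares (r * p)"
proof -
  have m: "m > 0" using assms by simp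
  have ndvd: "\<not> m dvd p"
    using assms(1-3) by (auto simp: prime_int_iff dest!: spec[of _ m])
  obtain a1 a2 a3 a4 where a: "m * p = a1\<^sup>2 + a2\<^sup>2 + a3\<^sup>2 + a4\<^sup>2"
    using assms(4) by (auto simp: four_squares_def)
  obtain b1 k1 where 1: "a1 = b1 + m * k1" "2 * \<bar>b1\<bar> \<le> m" using balanced_residue[OF m] .
  obtain b2 k2 where 2: "a2 = b2 + m * k2" "2 * \<bar>b2\<bar> \<le> m" using balanced_residue[OF m] .
  obtain b3 k3 where 3: "a3 = b3 + m * k3" "2 * \<bar>b3\<bar> \<le> m" using balanced_residue[OF m] .
  obtain b4 k4 where 4: "a4 = b4 + m * k4" "2 * \<bar>b4\<bar> \<le> m" using balanced_residue[OF m] .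
  define B where "B = b1\<^sup>2 + b2\<^sup>2 + b3\<^sup>2 + b4\<^sup>2"
  define K where "K = k1\<^sup>2 + k2\<^sup>2 + k3\<^sup>2 + k4\<^sup>2"
  define s where "s = b1 * k1 + b2 * k2 + b3 * k3 + b4 * k4"
  have mp: "m * p = B + m * (2 * s + m * K)"
    unfolding a B_def K_def s_def 1(1) 2(1) 3(1) 4(1)
    by (simp add: power2_eq_square algebra_simps)
  then have "B = m * (p - 2 * s - m * K)" by (simp add: algebra_simps)
  then obtain r where r: "B = m * r" by blast
  with mp have "m * p = m * (r + 2 * s + m * K)" by (simp add: algebra_simps)
  then have p: "p = r + 2 * s + m * K" using m by simp
  have sq: "(2 * b)\<^sup>2 \<le> m\<^sup>2" if "2 * \<bar>b\<bar> \<le> m" for b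
    using that by (intro power2_le_iff_abs_le[THEN iffD2]) (auto simp: m less_imp_le)
  have sqs: "(2 * b1)\<^sup>2 \<le> m\<^sup>2" "(2 * b2)\<^sup>2 \<le> m\<^sup>2" "(2 * b3)\<^sup>2 \<le> m\<^sup>2" "(2 * b4)\<^sup>2 \<le> m\<^sup>2"
    using sq 1(2) 2(2) 3(2) 4(2) by blast+
  have B4: "4 * B = (2 * b1)\<^sup>2 + (2 * b2)\<^sup>2 + (2 * b3)\<^sup>2 + (2 * b4)\<^sup>2"
    by (simp add: B_def power_mult_distrib)
  have "m * r \<le> m * m" using sqs B4 r by (simp add: power2_eq_square)
  then have "r \<le> m" using m by simp
  moreover have "r \<noteq> m"
  proof
    assume "r = m"
    then have "4 * B = 4 * m\<^sup>2" using r by (simp add: power2_eq_square)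
    \<comment> \<open>Equality must hold in all four bounds, so \<open>m\<close> divides every
      \<open>2 * b\<close>, hence \<open>2 * s\<close>, and finally \<open>p\<close>.\<close>
    then have "(2 * b1)\<^sup>2 = m\<^sup>2" "(2 * b2)\<^sup>2 = m\<^sup>2" "(2 * b3)\<^sup>2 = m\<^sup>2" "(2 * b4)\<^sup>2 = m\<^sup>2"
      using sqs B4 by linarith+
    then have "m dvd 2 * b1" "m dvd 2 * b2" "m dvd 2 * b3" "m dvd 2 * b4"
      by (metis pow_divides_pow_iff dvd_refl zero_less_numeral)+
    then have "m dvd 2 * b1 * k1 + 2 * b2 * k2 + 2 * b3 * k3 + 2 * b4 * k4"
      by (simp only: dvd_add dvd_mult2)
    then have "m dvd r + 2 * s + m * K"
      using \<open>r = m\<close> by (simp add: s_def algebra_simps)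
    then show False using p ndvd by simp
  qed
  moreover have "r \<noteq> 0"
  proof
    assume "r = 0"
    then have "b1\<^sup>2 + b2\<^sup>2 + b3\<^sup>2 + b4\<^sup>2 = 0" using r B_def by simp
    then have "b1\<^sup>2 = 0" "b2\<^sup>2 = 0" "b3\<^sup>2 = 0" "b4\<^sup>2 = 0"
      using zero_le_power2[of b1] zero_le_power2[of b2] zero_le_power2[of b3] zero_le_power2[of b4]
      by linarith+
    then have "s = 0" by (simp add: s_def)
    then show False using p ndvd \<open>r = 0\<close> by simp
  qed
  moreover have "0 \<le> m * r" unfolding r[symmetric] B_def by simp
  then have "0 \<le> r" using m by (simp add: zero_le_mult_iff)
  \<comment> \<open>As \<open>B = m * r\<close>, the summand \<open>r * m * K\<close> becomes
    \<open>B * K\<close>. Euler's identity writes \<open>B * K\<close> as \<open>s\<^sup>2\<close>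
    plus three squares.\<close>
  moreover have "r * p = (r + s)\<^sup>2 + (B * K - s\<^sup>2)"
    unfolding p using r by (simp add: power2_eq_square algebra_simps)
  then have "r * p = (r + s)\<^sup>2 + (b1 * k2 - b2 * k1 + b3 * k4 - b4 * k3)\<^sup>2 +
    (b1 * k3 - b2 * k4 - b3 * k1 + b4 * k2)\<^sup>2 + (b1 * k4 + b2 * k3 - b3 * k2 - b4 * k1)\<^sup>2"
    unfolding B_def K_def s_def euler_four_square_identity by simp
  then have "four_squares (r * p)" unfolding four_squares_def by blast
  ultimately show thesis using that[of r] by (simp add: less_le)
qed

text \<open>Pigeonhole: with \<open>p = 2 * h + 1\<close>, the squares of \<open>0..h\<close> and
  the numbers \<open>- 1 - j\<^sup>2\<close> each give \<open>h + 1\<close> residues, too many to be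
  disjoint modulo \<open>p\<close>. A common residue makes \<open>i\<^sup>2 + j\<^sup>2 + 1\<close>
  a multiple of \<open>p\<close>.\<close>

lemma four_squares_prime_multiple:
  fixes p :: int
  assumes "prime p" "odd p"
  obtains m where "0 < m" "m < p" "four_squares (m * p)"
proof -
  obtain h where h: "p = 2 * h + 1" using assms(2) by (elim oddE)
  have "p > 1" using assms(1) by (simp add: prime_gt_1_int)
  then have h0: "h > 0" using h by simp
  let ?f = "\<lambda>i. i\<^sup>2 mod p" and ?g = "\<lambda>i. (- 1 - i\<^sup>2) mod p"
  have inj: "i = j" if "0 \<le> i" "i \<le> h" "0 \<le> j" "j \<le> h" "p dvd i\<^sup>2 - j\<^sup>2" for i j
  proof (rule ccontr)
    assume "i \<noteq> j"
    have "i\<^sup>2 - j\<^sup>2 = (i + j) * (i - j)" by (simp add: power2_eq_square algebra_simps)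
    then have "p dvd i + j \<or> p dvd i - j"
      using that(5) assms(1) by (simp add: prime_dvd_mult_iff)
    \<comment> \<open>Both factors are nonzero and at most \<open>2 * h < p\<close> in absolute
      value.\<close>
    moreover have "i + j \<noteq> 0" "i - j \<noteq> 0" using that \<open>i \<noteq> j\<close> by linarith+
    ultimately have "p \<le> \<bar>i + j\<bar> \<or> p \<le> \<bar>i - j\<bar>" 
      by (metis dvd_imp_le_int abs_of_pos \<open>p > 1\<close> less_trans zero_less_one)
    then show False using that h by linarith
  qed
  have "inj_on ?f {0..h}"
    by (rule inj_onI) (auto intro: inj simp: mod_eq_dvd_iff)
  moreover have "inj_on ?g {0..h}"
  proof (rule inj_onI)
    fix i j assume "i \<in> {0..h}" "j \<in> {0..h}" "?g i = ?g j"
    then show "i = j" using inj[of j i] by (auto simp: mod_eq_dvd_iff algebra_simps)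
  qed
  ultimately have card: "card (?f ` {0..h}) = nat (h + 1)" "card (?g ` {0..h}) = nat (h + 1)"
    by (simp_all add: card_image)
  have "?f ` {0..h} \<inter> ?g ` {0..h} \<noteq> {}"
  proof
    assume "?f ` {0..h} \<inter> ?g ` {0..h} = {}"
    then have "card (?f ` {0..h} \<union> ?g ` {0..h}) = nat (h + 1) + nat (h + 1)"
      using card by (simp add: card_Un_disjoint)
    moreover have "card (?f ` {0..h} \<union> ?g ` {0..h}) \<le> card {0..<p}"
      using \<open>p > 1\<close> by (intro card_mono) auto
    ultimately show False using h h0 by simp
  qed
  then obtain i j where ij: "i \<in> {0..h}" "j \<in> {0..h}" "?f i = ?g j" by blast
  then have "p dvd i\<^sup>2 - (- 1 - j\<^sup>2)" by (simp only: mod_eq_dvd_iff)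
  then obtain m where m: "i\<^sup>2 + j\<^sup>2 + 1 = m * p"
    by (metis dvd_def mult.commute diff_minus_eq_add diff_diff_eq2)
  have "0 < i\<^sup>2 + j\<^sup>2 + 1" using zero_le_power2[of i] zero_le_power2[of j] by linarith
  then have "0 < m" using m \<open>p > 1\<close> by (simp add: zero_less_mult_iff)
  \<comment> \<open>Hence \<open>m * p \<le> 2 * h\<^sup>2 + 1\<close>, which is below
    \<open>p * p\<close>.\<close>
  have "i\<^sup>2 \<le> h\<^sup>2" "j\<^sup>2 \<le> h\<^sup>2" using ij by (auto intro: power_mono)
  moreover have "p * p = 4 * h\<^sup>2 + 4 * h + 1"
    by (simp add: h power2_eq_square algebra_simps)
  ultimately have "m * p < p * p"
    using m h0 zero_le_power2[of h] by linarith
  then have "m < p" using \<open>p > 1\<close> by simp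
  moreover have "four_squares (m * p)"
    unfolding four_squares_def m[symmetric]
    by (intro exI[of _ i] exI[of _ j] exI[of _ 1] exI[of _ 0]) simp
  ultimately show thesis using that \<open>0 < m\<close> by blast
qed

text \<open>For odd \<open>p\<close>, descent brings the factor \<open>m\<close> of a representable
  multiple \<open>m * p\<close> down to 1.\<close>

lemma four_squares_prime:
  fixes p :: int
  assumes "prime p"
  shows "four_squares p"
proof (cases "odd p")
  case True
  have "four_squares p" if "0 < int m" "int m < p" "four_squares (int m * p)" for m
    using that
  proof (induction m rule: less_induct)
    case (less m)
    show ?case
    proof (cases "m = 1")
      case False
      then have "1 < int m" using less.prems by simp
      then obtain r where r: "0 < r" "r < int m" "four_squares (r * p)"
        using four_squares_descent[OF assms _ less.prems(2,3)] by blast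
      then show ?thesis using less.IH[of "nat r"] less.prems by auto
    qed (use less.prems in simp)
  qed
  moreover obtain m where "0 < m" "m < p" "four_squares (m * p)"
    using four_squares_prime_multiple[OF assms True] .
  ultimately show ?thesis by (metis zero_less_imp_eq_int)
next
  case False
  then have "p = 2"
    using assms by (metis primes_dvd_imp_eq two_is_prime_nat prime_nat_int_transfer int_eq_iff_numeral)
  then have "p = 1\<^sup>2 + 1\<^sup>2 + 0\<^sup>2 + 0\<^sup>2" by simp
  then show ?thesis unfolding four_squares_def by blast
qed

theorem lagrange_four_squares: "four_squares (int n)"
proof (induction n rule: less_induct)
  case (less n)
  consider "n = 0" | "n = 1" | "n > 1" by linarith
  then show ?case
  proof cases
    case 1
    then have "int n = 0\<^sup>2 + 0\<^sup>2 + 0\<^sup>2 + 0\<^sup>2" by simp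
    then show ?thesis unfolding four_squares_def by blast
  next
    case 2
    then have "int n = 1\<^sup>2 + 0\<^sup>2 + 0\<^sup>2 + 0\<^sup>2" by simp
    then show ?thesis unfolding four_squares_def by blast
  next
    case 3
    then obtain q where q: "prime q" "q dvd n" by (metis prime_factor_nat less_irrefl)
    then obtain k where k: "n = q * k" by blast
    have "k < n" using k 3 prime_gt_1_nat[OF q(1)] by (cases "k = 0") simp_all
    moreover have "four_squares (int q)" using q by (intro four_squares_prime) simp
    ultimately show ?thesis using less k four_squares_mult by simp
  qed
qed


section \<open>Total recursive functions\<close>

text \<open>
  Entries of the environment at positions \<open>\<ge> k\<close> are out-of-range list entries. The environment is
  a function rather than a list, so that moving a term under a recursion merely replaces \<open>e j\<close> by
  \<open>e (Suc (Suc j))\<close> and the closure rules apply by higher-order unification.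
\<close>

definition total_rec :: "nat \<Rightarrow> ((nat \<Rightarrow> nat) \<Rightarrow> nat) \<Rightarrow> bool" where
  "total_rec k f \<longleftrightarrow> (\<exists>p. \<forall>xs. length xs = k \<longrightarrow> run p xs = Some (f ((!) xs)))"

section \<open>Composition and change of environment\<close>

lemma total_rec_proj: "i < k \<Longrightarrow> total_rec k (\<lambda>e. e i)"
  unfolding total_rec_def by (rule exI[of _ "Proj i"]) simp

lemma total_rec_comp:
  assumes "total_rec m f" "\<And>i. i < m \<Longrightarrow> total_rec k (g i)"
  shows "total_rec k (\<lambda>e. f ((!) (map (\<lambda>i. g i e) [0..<m])))"
proof -
  obtain p where p: "\<And>xs. length xs = m \<Longrightarrow> run p xs = Some (f ((!) xs))"
    using assms(1) unfolding total_rec_def by blast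
  obtain q where q: "\<And>i xs. i < m \<Longrightarrow> length xs = k \<Longrightarrow> run (q i) xs = Some (g i ((!) xs))"
    using assms(2) unfolding total_rec_def by metis
  have "run (Comp p (map q [0..<m])) xs = Some (f ((!) (map (\<lambda>i. g i ((!) xs)) [0..<m])))"
    if "length xs = k" for xs
  proof -
    have "map (\<lambda>h. run h xs) (map q [0..<m]) = map Some (map (\<lambda>i. g i ((!) xs)) [0..<m])"
      using q that by simp
    then show ?thesis using p[of "map (\<lambda>i. g i ((!) xs)) [0..<m]"]
      by (simp only: run.simps Let_def) (auto simp: comp_def)
  qed
  then show ?thesis unfolding total_rec_def by blast
qed

lemma total_rec_cong:
  assumes "total_rec k f" "\<And>xs. length xs = k \<Longrightarrow> f ((!) xs) = g ((!) xs)"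
  shows "total_rec k g"
  using assms unfolding total_rec_def by metis

lemma total_rec_shift:
  assumes "total_rec k f"
  shows "total_rec (d + k) (\<lambda>e. f (\<lambda>j. e (d + j)))"
proof (rule total_rec_cong)
  show "total_rec (d + k) (\<lambda>e. f ((!) (map (\<lambda>i. e (d + i)) [0..<k])))"
    using assms by (rule total_rec_comp) (simp add: total_rec_proj)
  fix xs :: "nat list"
  assume xs: "length xs = d + k"
  then have "map (\<lambda>i. xs ! (d + i)) [0..<k] = drop d xs"
    by (auto intro: nth_equalityI)
  \<comment> \<open>The two environments agree even at out-of-range indices, so nothing is required
    of \<open>f\<close> there.\<close>
  moreover have "(!) (drop d xs) = (\<lambda>j. xs ! (d + j))"
    using xs by (intro ext nth_drop) simp
  ultimately show "f ((!) (map (\<lambda>i. xs ! (d + i)) [0..<k])) = f (\<lambda>j. xs ! (d + j))"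
    by simp
qed

text \<open>Serves to evaluate a body at a computed index when \<open>d\<close> further entries,
  such as the counter and the value of a recursion, have been pushed in front of its
  parameters.\<close>

lemma total_rec_subst_head:
  assumes "total_rec (Suc k) (\<lambda>e. f (e 0) (\<lambda>j. e (Suc j)))" "total_rec (d + k) g"
  shows "total_rec (d + k) (\<lambda>e. f (g e) (\<lambda>j. e (d + j)))"
proof (rule total_rec_cong)
  let ?g = "\<lambda>i e. case i of 0 \<Rightarrow> g e | Suc j \<Rightarrow> e (d + j)"
  let ?l = "\<lambda>e. (!) (map (\<lambda>i. ?g i e) [0..<Suc k])"
  have "total_rec (d + k) (?g i)" if "i < Suc k" for i
    using that assms(2) by (cases i) (simp_all add: total_rec_proj)
  then show "total_rec (d + k) (\<lambda>e. f (?l e 0) (\<lambda>j. ?l e (Suc j)))"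
    by (rule total_rec_comp[OF assms(1)])
  fix xs :: "nat list"
  assume xs: "length xs = d + k"
  then have "map (\<lambda>i. ?g i ((!) xs)) [0..<Suc k] = g ((!) xs) # drop d xs"
    by (auto intro!: nth_equalityI simp: nth_Cons simp del: upt_Suc split: nat.split)
  moreover have "(!) (drop d xs) = (\<lambda>j. xs ! (d + j))"
    using xs by (intro ext nth_drop) simp
  ultimately show "f (?l ((!) xs) 0) (\<lambda>j. ?l ((!) xs) (Suc j)) = f (g ((!) xs)) (\<lambda>j. xs ! (d + j))"
    by simp
qed

text \<open>This rule and the next two reduce closure under an operation to the case where its
  arguments are projections. Projections remain projections inside the body of a recursion.\<close>

lemma total_rec_comp1:
  assumes "total_rec 1 (\<lambda>e. f (e 0))" "total_rec k g"
  shows "total_rec k (\<lambda>e. f (g e))"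
  using total_rec_comp[OF assms(1), of k "\<lambda>_. g"] assms(2) by simp

lemma total_rec_comp2:
  assumes "total_rec 2 (\<lambda>e. f (e 0) (e 1))" "total_rec k g" "total_rec k h"
  shows "total_rec k (\<lambda>e. f (g e) (h e))"
  using total_rec_comp[OF assms(1), of k "\<lambda>i. if i = 0 then g else h"] assms(2,3)
  by (simp add: upt_rec)

lemma total_rec_comp3:
  assumes "total_rec 3 (\<lambda>e. f (e 0) (e 1) (e 2))" "total_rec k g" "total_rec k h" "total_rec k l"
  shows "total_rec k (\<lambda>e. f (g e) (h e) (l e))"
  using total_rec_comp[OF assms(1), of k "\<lambda>i. if i = 0 then g else if i = 1 then h else l"] assms(2-)
  by (simp add: upt_rec)

lemma total_rec_Suc:
  assumes "total_rec k f"
  shows "total_rec k (\<lambda>e. Suc (f e))"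
proof -
  have "total_rec 1 (\<lambda>e. Suc (e 0))"
    unfolding total_rec_def by (rule exI[of _ Succ]) (auto simp: length_Suc_conv)
  then show ?thesis using assms by (rule total_rec_comp1)
qed

lemma total_rec_const: "total_rec k (\<lambda>_. c)"
proof (induction c)
  case 0
  show ?case unfolding total_rec_def by (rule exI[of _ Zero]) simp
qed (rule total_rec_Suc)

lemma total_rec_rec_nat:
  assumes "total_rec k a" "total_rec k n"
    and "total_rec (Suc (Suc k)) (\<lambda>e. s (e 0) (e 1) (\<lambda>j. e (Suc (Suc j))))"
  shows "total_rec k (\<lambda>e. rec_nat (a e) (\<lambda>i v. s i v e) (n e))"
proof -
  obtain p where p: "\<And>xs. length xs = k \<Longrightarrow> run p xs = Some (a ((!) xs))"
    using assms(1) unfolding total_rec_def by blast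
  obtain q where q: "\<And>xs. length xs = Suc (Suc k) \<Longrightarrow>
      run q xs = Some (s (xs ! 0) (xs ! 1) (\<lambda>j. xs ! Suc (Suc j)))"
    using assms(3) unfolding total_rec_def by blast
  have *: "run (Prim_Rec p q) (m # xs) = Some (rec_nat (a ((!) xs)) (\<lambda>i v. s i v ((!) xs)) m)"
    if "length xs = k" for m xs
    using that by (induction m) (simp_all add: p q)
  \<comment> \<open>First the number of iterations is the head entry; composition with
    \<open>t\<close> and projections then puts \<open>n e\<close> there.\<close>
  have "total_rec (Suc k) (\<lambda>e. rec_nat (a (\<lambda>j. e (Suc j))) (\<lambda>i v. s i v (\<lambda>j. e (Suc j))) (e 0))"
    unfolding total_rec_def
    by (rule exI[of _ "Prim_Rec p q"]) (auto simp: * length_Suc_conv simp del: run.simps)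
  then obtain r where r: "\<And>xs. length xs = Suc k \<Longrightarrow> run r xs =
      Some (rec_nat (a (\<lambda>j. xs ! Suc j)) (\<lambda>i v. s i v (\<lambda>j. xs ! Suc j)) (xs ! 0))"
    unfolding total_rec_def by blast
  obtain t where t: "\<And>xs. length xs = k \<Longrightarrow> run t xs = Some (n ((!) xs))"
    using assms(2) unfolding total_rec_def by blast
  have "run (Comp r (t # map Proj [0..<k])) xs =
      Some (rec_nat (a ((!) xs)) (\<lambda>i v. s i v ((!) xs)) (n ((!) xs)))" if "length xs = k" for xs
  proof -
    have "map (\<lambda>h. run h xs) (t # map Proj [0..<k]) = map Some (n ((!) xs) # xs)"
      using that t by (auto intro: nth_equalityI)
    then show ?thesis using r[of "n ((!) xs) # xs"] that
      by (simp only: run.simps Let_def) (auto simp: comp_def)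
  qed
  then show ?thesis unfolding total_rec_def by blast
qed

section \<open>Arithmetic and case distinctions\<close>

lemma total_rec_add:
  assumes "total_rec k f" "total_rec k g"
  shows "total_rec k (\<lambda>e. f e + g e)"
proof -
  have "m + n = rec_nat n (\<lambda>_ v. Suc v) m" for m n :: nat
    by (induction m) simp_all
  then show ?thesis
    using assms by (simp only:) (intro total_rec_rec_nat total_rec_Suc total_rec_proj; simp)
qed

lemma total_rec_diff:
  assumes "total_rec k f" "total_rec k g"
  shows "total_rec k (\<lambda>e. f e - g e)"
proof -
  have pred: "n - 1 = rec_nat 0 (\<lambda>i _. i) n" for n :: nat
    by (cases n) simp_all
  have "total_rec 1 (\<lambda>e. e 0 - 1)"
    unfolding pred by (intro total_rec_rec_nat total_rec_const total_rec_proj; simp)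
  then have step: "total_rec j h \<Longrightarrow> total_rec j (\<lambda>e. h e - 1)" for j h
    by (rule total_rec_comp1)
  have diff: "rec_nat m (\<lambda>_ v. v - 1) n = m - n" for m n :: nat
    by (induction n) simp_all
  have "total_rec k (\<lambda>e. rec_nat (f e) (\<lambda>_ v. v - 1) (g e))"
    using assms by (intro total_rec_rec_nat step total_rec_proj; simp)
  then show ?thesis unfolding diff .
qed

lemma total_rec_mult:
  assumes "total_rec k f" "total_rec k g"
  shows "total_rec k (\<lambda>e. f e * g e)"
proof -
  have mult: "m * n = rec_nat 0 (\<lambda>_ v. n + v) m" for m n :: nat
    by (induction m) simp_all
  have "total_rec 2 (\<lambda>e. e 0 * e 1)"
    unfolding mult by (intro total_rec_rec_nat total_rec_add total_rec_const total_rec_proj; simp)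
  then show ?thesis using assms by (rule total_rec_comp2)
qed

lemma total_rec_if_zero:
  assumes "total_rec k c" "total_rec k f" "total_rec k g"
  shows "total_rec k (\<lambda>e. if c e = 0 then f e else g e)"
proof -
  have if_zero: "(if m = 0 then x else y) = rec_nat x (\<lambda>_ _. y) m" for m x y :: nat
    by (cases m) simp_all
  have "total_rec 3 (\<lambda>e. if e 0 = 0 then e 1 else e 2)"
    unfolding if_zero by (intro total_rec_rec_nat total_rec_proj; simp)
  then show ?thesis using assms by (rule total_rec_comp3)
qed

lemma total_rec_if_less:
  assumes "total_rec k a" "total_rec k b" "total_rec k f" "total_rec k g"
  shows "total_rec k (\<lambda>e. if a e < b e then f e else g e)"
proof -
  \<comment> \<open>Subtraction truncates, so the tested difference is 0 iff
    \<open>a e < b e\<close>.\<close>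
  have "total_rec k (\<lambda>e. if Suc (a e) - b e = 0 then f e else g e)"
    using assms by (intro total_rec_if_zero total_rec_diff total_rec_Suc)
  then show ?thesis by (simp add: Suc_le_eq)
qed

lemma total_rec_if_eq:
  assumes "total_rec k a" "total_rec k b" "total_rec k f" "total_rec k g"
  shows "total_rec k (\<lambda>e. if a e = b e then f e else g e)"
proof -
  have "total_rec k (\<lambda>e. if (a e - b e) + (b e - a e) = 0 then f e else g e)"
    using assms by (intro total_rec_if_zero total_rec_add total_rec_diff)
  moreover have "(m - n) + (n - m) = 0 \<longleftrightarrow> m = n" for m n :: nat by auto
  ultimately show ?thesis by simp
qed

lemma total_rec_mod2:
  assumes "total_rec k f"
  shows "total_rec k (\<lambda>e. f e mod 2)"
proof -
  have "n mod 2 = rec_nat 0 (\<lambda>_ v. 1 - v) n" for n :: nat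
  proof (induction n)
    case (Suc n)
    have "Suc n mod 2 = 1 - n mod 2" by presburger
    then show ?case using Suc by simp
  qed simp
  then show ?thesis
    using assms by (simp only:) (intro total_rec_rec_nat total_rec_diff total_rec_const total_rec_proj; simp)
qed

lemma total_rec_div2:
  assumes "total_rec k f"
  shows "total_rec k (\<lambda>e. f e div 2)"
proof -
  \<comment> \<open>The recursion counts the odd numbers below \<open>n\<close>.\<close>
  have "n div 2 = rec_nat 0 (\<lambda>i v. v + i mod 2) n" for n :: nat
  proof (induction n)
    case (Suc n)
    have "Suc n div 2 = n div 2 + n mod 2" by presburger
    then show ?case using Suc by simp
  qed simp
  then show ?thesis
    using assms by (simp only:)
      (intro total_rec_rec_nat total_rec_add total_rec_mod2 total_rec_const total_rec_proj; simp)
qed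

section \<open>The Cantor pairing function and its inverse\<close>

lemma total_rec_triangle:
  assumes "total_rec k f"
  shows "total_rec k (\<lambda>e. triangle (f e))"
  unfolding triangle_def using assms by (intro total_rec_div2 total_rec_mult total_rec_Suc)

lemma total_rec_prod_encode:
  assumes "total_rec k f" "total_rec k g"
  shows "total_rec k (\<lambda>e. prod_encode (f e, g e))"
  unfolding prod_encode_def using assms by (simp add: total_rec_triangle total_rec_add)

text \<open>The largest \<open>v\<close> with \<open>triangle v \<le> n\<close>: the diagonal of the
  Cantor pairing on which \<open>n\<close> lies. It grows by at most one per step, so one comparison
  updates it.\<close>

definition triangle_root :: "nat \<Rightarrow> nat" where
  "triangle_root n = rec_nat 0 (\<lambda>i v. if Suc i < triangle (Suc v) then v else Suc v) n"

lemma triangle_root_bounds: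
  "triangle (triangle_root n) \<le> n \<and> n < triangle (Suc (triangle_root n))"
  by (induction n) (auto simp: triangle_root_def)

text \<open>The code of \<open>(a, b)\<close> is \<open>triangle (a + b) + a\<close> with
  \<open>a \<le> a + b\<close>, so it lies before the next triangular number and its root is
  \<open>a + b\<close>.\<close>

lemma prod_decode_triangle_root:
  "prod_decode n = (let s = triangle_root n; m = n - triangle s in (m, s - m))"
proof -
  have "triangle_root n = s" if "triangle s + m = n" "m \<le> s" for s m
  proof -
    have mono: "mono triangle" by (rule mono_iff_le_Suc[THEN iffD2]) simp
    have "s < Suc (triangle_root n)"
      using triangle_root_bounds[of n] that mono by (metis monoD le_add1 le_less_trans not_le)
    moreover have "triangle_root n < Suc s"
      using triangle_root_bounds[of n] that mono
      by (metis (no_types, lifting) monoD add_less_cancel_left le_imp_less_Suc le_less_trans not_le triangle_Suc)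
    ultimately show ?thesis by simp
  qed
  note root = this
  obtain a b where ab: "prod_decode n = (a, b)" by fastforce
  then have n: "triangle (a + b) + a = n"
    using prod_decode_inverse[of n] by (simp add: prod_encode_def)
  then have "triangle_root n = a + b" by (rule root) simp
  then show ?thesis using ab n by (auto simp: Let_def)
qed

lemma total_rec_triangle_root:
  assumes "total_rec k f"
  shows "total_rec k (\<lambda>e. triangle_root (f e))"
  unfolding triangle_root_def using assms
  by (intro total_rec_rec_nat total_rec_if_less total_rec_triangle total_rec_Suc total_rec_const
      total_rec_proj; simp)

lemma total_rec_fst_prod_decode:
  assumes "total_rec k f"
  shows "total_rec k (\<lambda>e. fst (prod_decode (f e)))"
  unfolding prod_decode_triangle_root Let_def fst_conv using assms
  by (intro total_rec_diff total_rec_triangle total_rec_triangle_root)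

lemma total_rec_snd_prod_decode:
  assumes "total_rec k f"
  shows "total_rec k (\<lambda>e. snd (prod_decode (f e)))"
  unfolding prod_decode_triangle_root Let_def snd_conv using assms
  by (intro total_rec_diff total_rec_triangle total_rec_triangle_root)

section \<open>Codes of lists\<close>

text \<open>
  Beyond the end of the list the value is 0, because \<open>prod_decode 0 = (0, 0)\<close> and the predecessor of
  0 is 0. Thus a missing term of an encoded equation reads as a term with coefficient 0, and any
  upper bound can stand in for the length of a list.
\<close>

definition code_nth :: "nat \<Rightarrow> nat \<Rightarrow> nat" where
  "code_nth c i = fst (prod_decode (rec_nat c (\<lambda>_ v. snd (prod_decode (v - 1))) i - 1))"

lemma prod_decode_0: "prod_decode 0 = (0, 0)"
  by (simp add: prod_decode_def prod_decode_aux.simps)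

lemma code_nth_list_encode:
  "code_nth (list_encode xs) i = (if i < length xs then xs ! i else 0)"
proof -
  have "rec_nat (list_encode xs) (\<lambda>_ v. snd (prod_decode (v - 1))) i = list_encode (drop i xs)"
  proof (induction i)
    case (Suc i)
    show ?case
    proof (cases "i < length xs")
      case True
      then show ?thesis using Suc by (simp flip: Cons_nth_drop_Suc)
    qed (use Suc in \<open>simp add: prod_decode_0\<close>)
  qed simp
  then show ?thesis
    by (cases "i < length xs") (simp_all add: code_nth_def prod_decode_0 flip: Cons_nth_drop_Suc)
qed

lemma total_rec_code_nth:
  assumes "total_rec k f" "total_rec k g"
  shows "total_rec k (\<lambda>e. code_nth (f e) (g e))"
  unfolding code_nth_def using assms
  by (intro total_rec_fst_prod_decode total_rec_diff total_rec_rec_nat total_rec_snd_prod_decode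
      total_rec_const total_rec_proj; simp)

lemma total_rec_list_encode_map_upt:
  assumes "total_rec k n"
    and "total_rec (Suc k) (\<lambda>e. f (e 0) (\<lambda>j. e (Suc j)))"
  shows "total_rec k (\<lambda>e. list_encode (map (\<lambda>i. f i e) [0..<n e]))"
proof -
  \<comment> \<open>A list code is built from its last entry, so stage \<open>i\<close> of the
    recursion prepends the entry with index \<open>n e - Suc i\<close>.\<close>
  have eq: "list_encode (map (\<lambda>i. f i e) [0..<n e]) =
      rec_nat 0 (\<lambda>i v. Suc (prod_encode (f (n e - Suc i) e, v))) (n e)" for e
  proof -
    have "j \<le> n e \<Longrightarrow> rec_nat 0 (\<lambda>i v. Suc (prod_encode (f (n e - Suc i) e, v))) j =
        list_encode (map (\<lambda>i. f i e) [n e - j..<n e])" for j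
    proof (induction j)
      case (Suc j)
      then have "[n e - Suc j..<n e] = (n e - Suc j) # [n e - j..<n e]"
        by (subst upt_conv_Cons) (auto simp: Suc_diff_Suc)
      with Suc show ?case by simp
    qed simp
    then show ?thesis by simp
  qed
  have "total_rec (Suc (Suc k)) (\<lambda>e. f (n (\<lambda>j. e (Suc (Suc j))) - Suc (e 0)) (\<lambda>j. e (Suc (Suc j))))"
    using total_rec_subst_head[where d = 2, OF assms(2)] total_rec_shift[OF assms(1), of 2]
    by (simp add: total_rec_diff total_rec_Suc total_rec_proj)
  then show ?thesis unfolding eq using assms(1)
    by (intro total_rec_rec_nat total_rec_Suc total_rec_prod_encode total_rec_const total_rec_proj; simp)
qed


section \<open>The auxiliary equation\<close>

text \<open>
  Under \<open>int_encode\<close>, the code \<open>c\<close> has absolute value \<open>(c + 1) div 2\<close> and is odd iff the integer is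
  negative. The subtraction truncates when a factor is 0.
\<close>

definition mult_code :: "nat \<Rightarrow> nat \<Rightarrow> nat" where
  "mult_code a b = 2 * (Suc a div 2) * (Suc b div 2) - (a + b) mod 2"

lemma int_decode_even: "int_decode (2 * a) = int a"
  using int_encode_inverse[of "int a"] by (simp add: int_encode_def sum_encode_def)

lemma int_decode_odd: "int_decode (2 * a + 1) = - int a - 1"
  using int_encode_inverse[of "- int a - 1"] by (simp add: int_encode_def sum_encode_def)

text \<open>This includes \<open>a = 0\<close>, where the subtraction truncates to 0, the code of 0.
  Products with a zero factor are thereby covered.\<close>

lemma int_decode_pred: "int_decode (2 * a - 1) = - int a"
  using int_decode_odd[of "a - 1"] int_decode_even[of 0] by (cases a) simp_all

text \<open>In both cases \<open>a\<close> is the absolute value of the encoded integer; the second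
  case is that of the negative integers.\<close>

lemma code_cases:
  obtains a where "x = 2 * a" | a where "a > 0" "x = 2 * a - (1 :: nat)"
proof (cases "even x")
  case False
  then obtain b where "x = 2 * b + 1" by (elim oddE)
  then show thesis using that(2)[of "Suc b"] by simp
qed (use that(1) in \<open>auto elim: evenE\<close>)

lemma int_decode_mult_code: "int_decode (mult_code x y) = int_decode x * int_decode y"
proof -
  have half: "Suc (2 * a) div 2 = a" "a > 0 \<Longrightarrow> Suc (2 * a - 1) div 2 = a" for a :: nat
    by simp_all
  have par: "(2 * a + 2 * b) mod 2 = 0" "b > 0 \<Longrightarrow> (2 * a + (2 * b - 1)) mod 2 = 1"
    "a > 0 \<Longrightarrow> (2 * a - 1 + 2 * b) mod 2 = 1"
    "a > 0 \<Longrightarrow> b > 0 \<Longrightarrow> (2 * a - 1 + (2 * b - 1)) mod 2 = 0" for a b :: nat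
    by presburger+
  note eqs = mult_code_def half par mult.assoc int_decode_even int_decode_pred diff_zero of_nat_mult
    mult_minus_left mult_minus_right minus_minus
  show ?thesis
    by (cases x rule: code_cases; cases y rule: code_cases) (simp_all only: eqs)
qed

lemma total_rec_mult_code:
  assumes "total_rec k f" "total_rec k g"
  shows "total_rec k (\<lambda>e. mult_code (f e) (g e))"
  unfolding mult_code_def using assms
  by (intro total_rec_diff total_rec_mult total_rec_div2 total_rec_mod2 total_rec_add total_rec_Suc
      total_rec_const)

text \<open>
  With \<open>d\<close> encoding the terms of \<open>D\<close>, index \<open>i\<close> stands for the term \<open>x\<^sub>i\<^sup>2\<close> if \<open>i < n\<close>, for a term
  \<open>- y\<^sub>j\<^sup>2\<close> if \<open>n \<le> i < n + 5\<close>, and for term \<open>i - (n + 5)\<close> of \<open>D\<close> otherwise. The codes of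
  1 and -1 are 2 and 1. In the sum of the two squares, products of a term of the first two kinds
  with a term of \<open>D\<close> do not occur. The bound \<open>n + 5 + d\<close> on the indices is large enough because
  the code of a list is at least its length.
\<close>

definition term_coeff :: "nat \<Rightarrow> nat \<Rightarrow> nat \<Rightarrow> nat" where
  "term_coeff n d i =
     (if i < n then 2 else if i < n + 5 then 1 else fst (prod_decode (code_nth d (i - (n + 5)))))"

definition term_exp :: "nat \<Rightarrow> nat \<Rightarrow> nat \<Rightarrow> nat \<Rightarrow> nat" where
  "term_exp n d i m =
     (if i < n + 5 then if i = m then 2 else 0
      else code_nth (snd (prod_decode (code_nth d (i - (n + 5))))) m)"

definition pair_coeff :: "nat \<Rightarrow> nat \<Rightarrow> nat \<Rightarrow> nat \<Rightarrow> nat" where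
  "pair_coeff n d i j =
     (if i < n + 5
      then if j < n + 5 then mult_code (term_coeff n d i) (term_coeff n d j) else 0
      else if j < n + 5 then 0 else mult_code (term_coeff n d i) (term_coeff n d j))"

definition height_eq :: "nat \<Rightarrow> nat \<Rightarrow> dioph_eq" where
  "height_eq n d =
     (n + 5,
      map (\<lambda>k. (int_decode (pair_coeff n d (fst (prod_decode k)) (snd (prod_decode k))),
                map (\<lambda>m. term_exp n d (fst (prod_decode k)) m + term_exp n d (snd (prod_decode k)) m)
                  [0..<n + 5]))
        [0..<prod_encode (n + 5 + d, n + 5 + d)])"

lemma height_eq_in_dioph_eqs: "height_eq n d \<in> dioph_eqs"
  by (auto simp: height_eq_def dioph_eqs_def)

lemma total_rec_term_coeff:
  assumes "total_rec k n" "total_rec k d" "total_rec k i"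
  shows "total_rec k (\<lambda>e. term_coeff (n e) (d e) (i e))"
  unfolding term_coeff_def using assms
  by (intro total_rec_if_less total_rec_add total_rec_const total_rec_fst_prod_decode
      total_rec_code_nth total_rec_diff)

lemma total_rec_term_exp:
  assumes "total_rec k n" "total_rec k d" "total_rec k i" "total_rec k m"
  shows "total_rec k (\<lambda>e. term_exp (n e) (d e) (i e) (m e))"
  unfolding term_exp_def using assms
  by (intro total_rec_if_less total_rec_if_eq total_rec_add total_rec_const
      total_rec_snd_prod_decode total_rec_code_nth total_rec_diff)

lemma total_rec_pair_coeff:
  assumes "total_rec k n" "total_rec k d" "total_rec k i" "total_rec k j"
  shows "total_rec k (\<lambda>e. pair_coeff (n e) (d e) (i e) (j e))"
  unfolding pair_coeff_def using assms
  by (intro total_rec_if_less total_rec_add total_rec_const total_rec_mult_code total_rec_term_coeff)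

text \<open>\<open>int_encode\<close> cancels \<open>int_decode\<close>, so the code of the new
  equation is expressed by operations on natural numbers alone.\<close>

lemma encode_height_eq:
  "encode_eq (height_eq n d) =
     prod_encode (n + 5,
       list_encode (map (\<lambda>k. prod_encode
         (pair_coeff n d (fst (prod_decode k)) (snd (prod_decode k)),
          list_encode (map (\<lambda>m. term_exp n d (fst (prod_decode k)) m +
            term_exp n d (snd (prod_decode k)) m) [0..<n + 5])))
         [0..<prod_encode (n + 5 + d, n + 5 + d)]))"
  by (simp add: encode_eq_def height_eq_def comp_def)

lemma total_rec_encode_height_eq:
  "total_rec 1 (\<lambda>e. encode_eq (height_eq (fst (prod_decode (e 0))) (snd (prod_decode (e 0)))))"
  unfolding encode_height_eq
  by (intro total_rec_prod_encode total_rec_list_encode_map_upt total_rec_pair_coeff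
      total_rec_term_exp total_rec_add total_rec_fst_prod_decode total_rec_snd_prod_decode
      total_rec_const total_rec_proj; simp)

section \<open>Value of the auxiliary polynomial\<close>

lemma length_le_list_encode: "length xs \<le> list_encode xs"
proof (induction xs)
  case (Cons x xs)
  then show ?case using le_prod_encode_2[of "list_encode xs" x] by simp
qed simp

lemma prod_encode_less:
  assumes "i < m" "j < m"
  shows "prod_encode (i, j) < prod_encode (m, m)"
proof -
  note assms
  moreover have "mono triangle" by (rule mono_iff_le_Suc[THEN iffD2]) simp
  ultimately have "triangle (i + j) \<le> triangle (m + m)" by (intro monoD[of triangle]) simp_all
  then show ?thesis using assms(1) by (simp add: prod_encode_def)
qed

text \<open>By \<open>prod_encode_less\<close>, the codes below \<open>prod_encode (m, m)\<close>
  include all pairs from the square of side \<open>m\<close>. The other pairs among them contribute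
  0.\<close>

lemma sum_prod_decode_square:
  fixes w :: "nat \<Rightarrow> nat \<Rightarrow> 'a :: comm_monoid_add"
  assumes "\<And>i j. i \<ge> m \<or> j \<ge> m \<Longrightarrow> w i j = 0"
  shows "(\<Sum>k<prod_encode (m, m). w (fst (prod_decode k)) (snd (prod_decode k))) =
    (\<Sum>i<m. \<Sum>j<m. w i j)"
proof -
  let ?A = "prod_decode ` {..<prod_encode (m, m)}"
  have box: "i < m \<and> j < m" if "w i j \<noteq> 0" for i j
    using assms that by (metis not_le)
  have "(\<Sum>k<prod_encode (m, m). w (fst (prod_decode k)) (snd (prod_decode k))) =
      (\<Sum>(i, j)\<in>?A. w i j)"
    by (subst sum.reindex) (simp_all add: inj_prod_decode case_prod_unfold)
  also have "\<dots> = (\<Sum>(i, j)\<in>{..<m} \<times> {..<m}. w i j)"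
  proof (rule sum.mono_neutral_right)
    show "{..<m} \<times> {..<m} \<subseteq> ?A"
    proof
      fix p assume "p \<in> {..<m} \<times> {..<m}"
      then show "p \<in> ?A"
        by (intro image_eqI[of _ _ "prod_encode p"]) (auto simp: prod_encode_less)
    qed
  qed (auto dest: box)
  finally show ?thesis by (simp add: sum.cartesian_product)
qed

lemma sum_list_map_eq_sum:
  fixes f :: "'a \<Rightarrow> 'b :: comm_monoid_add"
  shows "(\<Sum>x\<leftarrow>xs. f x) = (\<Sum>i<length xs. f (xs ! i))"
  by (simp add: sum_list_sum_nth atLeast0LessThan)

text \<open>Of the four blocks of the double sum the mixed ones vanish and the diagonal ones are
  squares.\<close>

lemma sum_squares_of_parts:
  fixes u :: "nat \<Rightarrow> int"
  shows "(\<Sum>i<a + b. \<Sum>j<a + b. if i < a \<longleftrightarrow> j < a then u i * u j else 0) =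
    (\<Sum>i<a. u i)\<^sup>2 + (\<Sum>i<b. u (a + i))\<^sup>2"
proof -
  have split: "(\<Sum>i<a + b. f i) = (\<Sum>i<a. f i) + (\<Sum>i<b. f (a + i))" for f :: "nat \<Rightarrow> int"
    by (induction b) (simp_all add: add.assoc)
  show ?thesis unfolding split by (simp add: power2_eq_square sum_product)
qed

lemma poly_value_height_eq:
  assumes "(n, D) \<in> dioph_eqs" "length z = n + 5"
    and d: "d = list_encode (map (\<lambda>(c, es). prod_encode (int_encode c, list_encode es)) D)"
  shows "poly_value (height_eq n d) z =
    ((\<Sum>i<n. (z ! i)\<^sup>2) - (\<Sum>i<5. (z ! (n + i))\<^sup>2))\<^sup>2 + (poly_value (n, D) (take n z))\<^sup>2"
proof -
  \<comment> \<open>The value at \<open>z\<close> of the term with index \<open>i\<close>.\<close>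
  define u where "u i = int_decode (term_coeff n d i) * (\<Prod>m<n + 5. z ! m ^ term_exp n d i m)" for i
  let ?m = "n + 5 + d"
  have nth_d: "code_nth d i =
      (if i < length D then prod_encode (int_encode (fst (D ! i)), list_encode (snd (D ! i))) else 0)" for i
    by (simp add: d code_nth_list_encode case_prod_unfold)
  have int_decode_0: "int_decode 0 = 0" using int_decode_even[of 0] by simp
  have len_D: "length D \<le> d"
    using length_le_list_encode[of "map (\<lambda>(c, es). prod_encode (int_encode c, list_encode es)) D"]
    by (simp add: d)
  have u0: "u i = 0" if "i \<ge> n + 5 + length D" for i
  proof -
    have "term_coeff n d i = 0"
      using that by (simp add: term_coeff_def nth_d prod_decode_0)
    then show ?thesis by (simp add: u_def int_decode_0)
  qed
  have uR: "u i = (if i < n then 1 else - 1) * (z ! i)\<^sup>2" if "i < n + 5" for i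
  proof -
    have "(\<Prod>m<n + 5. z ! m ^ term_exp n d i m) = (\<Prod>m<n + 5. if i = m then (z ! m)\<^sup>2 else 1)"
      using that by (intro prod.cong) (simp_all add: term_exp_def)
    also have "\<dots> = (z ! i)\<^sup>2" using that by simp
    finally show ?thesis
      using that int_decode_even[of 1] int_decode_odd[of 0] by (simp add: u_def term_coeff_def)
  qed
  have uD: "u (n + 5 + i) = fst (D ! i) * (\<Prod>m<n. take n z ! m ^ (snd (D ! i) ! m))"
    if "i < length D" for i
  proof -
    have "length (snd (D ! i)) = n"
      using assms(1) nth_mem[OF that] by (auto simp: dioph_eqs_def)
    \<comment> \<open>At the five new variables the exponent is read past the end of a list of
      length \<open>n\<close>, which gives 0.\<close>
    then have "term_exp n d (n + 5 + i) m = (if m < n then snd (D ! i) ! m else 0)" for m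
      using that by (simp add: term_exp_def nth_d code_nth_list_encode)
    then have "(\<Prod>m<n + 5. z ! m ^ term_exp n d (n + 5 + i) m) =
        (\<Prod>m<n + 5. if m < n then z ! m ^ (snd (D ! i) ! m) else 1)"
      by (intro prod.cong) simp_all
    also have "\<dots> = (\<Prod>m<n. take n z ! m ^ (snd (D ! i) ! m))"
      by (intro prod.mono_neutral_cong_right) auto
    finally show ?thesis using that by (simp add: u_def term_coeff_def nth_d)
  qed
  have pair: "int_decode (pair_coeff n d i j) *
      (\<Prod>m<n + 5. z ! m ^ (term_exp n d i m + term_exp n d j m)) =
      (if i < n + 5 \<longleftrightarrow> j < n + 5 then u i * u j else 0)" for i j
    by (simp add: pair_coeff_def u_def int_decode_mult_code int_decode_0 power_add prod.distrib)
  have "poly_value (height_eq n d) z = (\<Sum>k<prod_encode (?m, ?m).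
      int_decode (pair_coeff n d (fst (prod_decode k)) (snd (prod_decode k))) *
      (\<Prod>m<n + 5. z ! m ^ (term_exp n d (fst (prod_decode k)) m + term_exp n d (snd (prod_decode k)) m)))"
    by (simp add: poly_value_def height_eq_def sum_list_map_eq_sum)
  also have "\<dots> = (\<Sum>i<n + 5 + d. \<Sum>j<n + 5 + d. if i < n + 5 \<longleftrightarrow> j < n + 5 then u i * u j else 0)"
    unfolding pair using len_D by (intro sum_prod_decode_square) (auto simp: u0)
  also have "\<dots> = (\<Sum>i<n + 5. u i)\<^sup>2 + (\<Sum>i<d. u (n + 5 + i))\<^sup>2"
    by (rule sum_squares_of_parts)
  also have "(\<Sum>i<n + 5. u i) = (\<Sum>i<n. u i) + (\<Sum>i<5. u (n + i))"
    by (simp add: eval_nat_numeral)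
  also have "\<dots> = (\<Sum>i<n. (z ! i)\<^sup>2) - (\<Sum>i<5. (z ! (n + i))\<^sup>2)"
    by (simp add: uR sum_negf)
  also have "(\<Sum>i<d. u (n + 5 + i)) = (\<Sum>i<length D. u (n + 5 + i))"
    using len_D by (intro sum.mono_neutral_right) (auto simp: u0)
  also have "\<dots> = poly_value (n, D) (take n z)"
    by (simp add: uD poly_value_def sum_list_map_eq_sum case_prod_unfold)
  finally show ?thesis .
qed

section \<open>Finiteness and number of the auxiliary solutions\<close>

lemma solutions_height_eq:
  assumes "(n, D) \<in> dioph_eqs"
    and "d = list_encode (map (\<lambda>(c, es). prod_encode (int_encode c, list_encode es)) D)"
  shows "solutions (height_eq n d) =
    {x @ y |x y. x \<in> solutions (n, D) \<and> length y = 5 \<and> (\<Sum>i<n. (x ! i)\<^sup>2) = (\<Sum>i<5. (y ! i)\<^sup>2)}"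
    (is "_ = ?R")
proof (intro equalityI subsetI)
  fix z assume "z \<in> solutions (height_eq n d)"
  then have len: "length z = n + 5" and "poly_value (height_eq n d) z = 0"
    by (simp_all add: solutions_def height_eq_def)
  \<comment> \<open>A sum of two integer squares vanishes only if both do.\<close>
  then have *: "(\<Sum>i<n. (z ! i)\<^sup>2) = (\<Sum>i<5. (z ! (n + i))\<^sup>2)" "poly_value (n, D) (take n z) = 0"
    by (simp_all add: poly_value_height_eq[OF assms(1) len assms(2)] sum_power2_eq_zero_iff)
  have "z = take n z @ drop n z" by simp
  moreover have "take n z \<in> solutions (n, D)" using * len by (simp add: solutions_def)
  moreover have "(\<Sum>i<n. (take n z ! i)\<^sup>2) = (\<Sum>i<5. (drop n z ! i)\<^sup>2)" using * len by simp
  moreover have "length (drop n z) = 5" using len by simp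
  ultimately show "z \<in> ?R" by blast
next
  fix z assume "z \<in> ?R"
  then obtain x y where z: "z = x @ y" and x: "x \<in> solutions (n, D)" and y: "length y = 5"
    "(\<Sum>i<n. (x ! i)\<^sup>2) = (\<Sum>i<5. (y ! i)\<^sup>2)" by blast
  have len: "length z = n + 5" using z x y by (simp add: solutions_def)
  show "z \<in> solutions (height_eq n d)"
    using x y poly_value_height_eq[OF assms(1) len assms(2)]
    by (simp add: z solutions_def height_eq_def nth_append)
qed

text \<open>Each entry of \<open>y\<close> satisfies \<open>\<bar>a\<bar> \<le> a\<^sup>2\<close>,
  and \<open>a\<^sup>2\<close> is at most the sum of the squares of \<open>x\<close>. So only
  finitely many \<open>y\<close> belong to each \<open>x\<close>.\<close>

lemma finite_solutions_height_eq:
  assumes "(n, D) \<in> dioph_eqs"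
    and "d = list_encode (map (\<lambda>(c, es). prod_encode (int_encode c, list_encode es)) D)"
    and "finite (solutions (n, D))"
  shows "finite (solutions (height_eq n d))"
proof (rule finite_subset)
  let ?s = "\<lambda>x :: int list. \<Sum>i<n. (x ! i)\<^sup>2"
  let ?B = "\<lambda>x. {y. set y \<subseteq> {- ?s x..?s x} \<and> length y = 5}"
  show "finite (\<Union>x\<in>solutions (n, D). (\<lambda>y. x @ y) ` ?B x)"
    using assms(3) by (intro finite_UN_I finite_imageI finite_lists_length_eq) simp_all
  have "set y \<subseteq> {- ?s x..?s x}" if "length y = 5" "?s x = (\<Sum>i<5. (y ! i)\<^sup>2)" for x y :: "int list"
  proof
    fix a assume "a \<in> set y"
    then obtain i where i: "i < length y" "y ! i = a" unfolding in_set_conv_nth by blast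
    have "(y ! i)\<^sup>2 \<le> ?s x" unfolding that(2) using i(1) that(1) by (intro member_le_sum) auto
    then have "a\<^sup>2 \<le> ?s x" using i(2) by simp
    moreover have "\<bar>a\<bar> * 1 \<le> \<bar>a\<bar> * \<bar>a\<bar>"
      using mult_left_mono[of 1 "\<bar>a\<bar>" "\<bar>a\<bar>"] by (cases "a = 0") auto
    then have "\<bar>a\<bar> \<le> a\<^sup>2" by (simp add: power2_eq_square)
    ultimately show "a \<in> {- ?s x..?s x}" by auto
  qed
  then show "solutions (height_eq n d) \<subseteq> (\<Union>x\<in>solutions (n, D). (\<lambda>y. x @ y) ` ?B x)"
    unfolding solutions_height_eq[OF assms(1,2)] by fast
qed

lemma height_less_card_solutions_height_eq:
  assumes "(n, D) \<in> dioph_eqs"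
    and "d = list_encode (map (\<lambda>(c, es). prod_encode (int_encode c, list_encode es)) D)"
    and "finite (solutions (n, D))" "x \<in> solutions (n, D)"
  shows "height x < int (card (solutions (height_eq n d)))"
proof -
  have len: "length x = n" "n \<ge> 1" using assms by (simp_all add: solutions_def dioph_eqs_def)
  define s where "s = (\<Sum>i<n. (x ! i)\<^sup>2)"
  \<comment> \<open>The maximum is attained because \<open>n \<ge> 1\<close> makes
    \<open>set x\<close> nonempty.\<close>
  have "height x \<in> abs ` set x" unfolding height_def using len by (intro Max_in) auto
  then obtain j where j: "j < n" "height x = \<bar>x ! j\<bar>" using len by (auto simp: in_set_conv_nth)
  have "(x ! j)\<^sup>2 \<le> s" unfolding s_def using j by (intro member_le_sum) auto
  then have h: "(height x)\<^sup>2 \<le> s" by (simp add: j)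
  have "\<exists>y. length y = 5 \<and> hd y = a \<and> s = (\<Sum>i<5. (y ! i)\<^sup>2)" if "a \<in> {0..height x}" for a
  proof -
    have "a\<^sup>2 \<le> (height x)\<^sup>2" using that by (intro power_mono) auto
    then have "four_squares (s - a\<^sup>2)" using lagrange_four_squares[of "nat (s - a\<^sup>2)"] h by simp
    then obtain b c d e where "s - a\<^sup>2 = b\<^sup>2 + c\<^sup>2 + d\<^sup>2 + e\<^sup>2" by (auto simp: four_squares_def)
    then show ?thesis
      by (intro exI[of _ "[a, b, c, d, e]"]) (simp add: eval_nat_numeral)
  qed
  then obtain y where y: "\<And>a. a \<in> {0..height x} \<Longrightarrow>
      length (y a) = 5 \<and> hd (y a) = a \<and> s = (\<Sum>i<5. (y a ! i)\<^sup>2)"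
    by metis
  \<comment> \<open>The first entry of \<open>y a\<close> recovers \<open>a\<close>.\<close>
  have "inj_on (\<lambda>a. x @ y a) {0..height x}"
    using y by (intro inj_onI) (metis same_append_eq)
  moreover have "(\<lambda>a. x @ y a) ` {0..height x} \<subseteq> solutions (height_eq n d)"
    unfolding solutions_height_eq[OF assms(1,2)] using y assms(4) s_def by fast
  \<comment> \<open>Finiteness matters here: \<open>card\<close> of an infinite set is 0.\<close>
  ultimately have "card {0..height x} \<le> card (solutions (height_eq n d))"
    by (intro card_inj_on_le finite_solutions_height_eq[OF assms(1-3)])
  then show ?thesis by simp
qed

section \<open>From a bound on the number of solutions to a bound on heights\<close>

theorem theorem1:
  assumes "\<exists>F. computable F \<and>
             (\<forall>E \<in> dioph_eqs. finite (solutions E) \<longrightarrow> F E > int (card (solutions E)))"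
  shows "\<exists>G. computable G \<and>
           (\<forall>E \<in> dioph_eqs. finite (solutions E) \<longrightarrow> (\<forall>x \<in> solutions E. G E > height x))"
proof -
  obtain F where F: "computable F"
      "\<And>E. E \<in> dioph_eqs \<Longrightarrow> finite (solutions E) \<Longrightarrow> int (card (solutions E)) < F E"
    using assms by blast
  \<comment> \<open>\<open>T\<close> works on codes and reads any number as a pair, so it yields a
    valid equation for every input.\<close>
  define T where "T c = height_eq (fst (prod_decode c)) (snd (prod_decode c))" for c
  have T: "T (encode_eq (n, D)) =
      height_eq n (list_encode (map (\<lambda>(c, es). prod_encode (int_encode c, list_encode es)) D))" for n D
    by (simp add: T_def encode_eq_def)
  have T_mem: "T c \<in> dioph_eqs" for c
    unfolding T_def by (rule height_eq_in_dioph_eqs)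
  obtain p where p: "\<And>E. E \<in> dioph_eqs \<Longrightarrow> run p [encode_eq E] = Some (int_encode (F E))"
    using F(1) unfolding computable_def by blast
  obtain q where q: "\<And>xs. length xs = 1 \<Longrightarrow> run q xs = Some (encode_eq (T (xs ! 0)))"
    using total_rec_encode_height_eq unfolding total_rec_def T_def by blast
  have "run (Comp p [q]) [encode_eq E] = Some (int_encode (F (T (encode_eq E))))" for E
    using q[of "[encode_eq E]"] p[OF T_mem] by simp
  then have "computable (\<lambda>E. F (T (encode_eq E)))" unfolding computable_def by blast
  moreover have "height x < F (T (encode_eq E))"
    if "E \<in> dioph_eqs" "finite (solutions E)" "x \<in> solutions E" for E x
  proof -
    obtain n D where E: "E = (n, D)" by fastforce
    have "height x < int (card (solutions (T (encode_eq E))))"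
      using height_less_card_solutions_height_eq[OF _ refl] that by (simp add: E T)
    also have "\<dots> < F (T (encode_eq E))"
      using finite_solutions_height_eq[OF _ refl] that T_mem[of "encode_eq E"]
      by (intro F(2)) (simp_all add: E T)
    finally show ?thesis .
  qed
  ultimately show ?thesis by blast
qed

end
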